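(* Let $(k(n))_{n\ge 1}$ be a sequence of positive integers with $k(n)\to+\infty$, and let $X=\{\{X_{k,n},\ 1\le k\le k(n)\},\ n\ge 1\}$ be an array of random variables defined on the same probability space $(\Omega,\mathcal{A},\mathbb{P})$ such that, for each $n\ge 1$, the variables $X_{1,n},\dots,X_{k(n),n}$ are independent. Suppose that: (1) for all $n\ge 1$ and all $1\le k\le k(n)$, $X_{k,n}\sim\mathcal{B}(p_{k,n})$ (Bernoulli) with $0<p_{k,n}<1$; (2) $\sup_{1\le k\le k(n)} p_{k,n}\to 0$ as $n\to+\infty$; (3) $\sum_{1\le k\le k(n)} p_{k,n}\to\lambda$ as $n\to+\infty$, for some $\lambda\in\,]0,+\infty[$. Then $S_n[X]=\sum_{k=1}^{k(n)}X_{k,n}$ converges in distribution, as $n\to+\infty$, to the Poisson law $\mathcal{P}(\lambda)$.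
   Context: $\mathcal{B}(p)$ denotes the Bernoulli law with $\mathbb{P}(X=1)=p=1-\mathbb{P}(X=0)$. $\mathcal{P}(\lambda)$ denotes the Poisson law with parameter $\lambda$. Within a row the variables need not be identically distributed, and nothing is assumed about dependence between different rows. *)

theory Defs
  imports "HOL-Probability.Probability"
begin

text \<open>
  The library's Bernoulli and Poisson distributions live on \<open>bool\<close> and \<open>nat\<close>;
  the following are their images on the Borel sets of the real line.
\<close>

definition bernoulli_law :: "real \<Rightarrow> real measure" where
  "bernoulli_law p = distr (measure_pmf (bernoulli_pmf p)) borel of_bool"

definition poisson_law :: "real \<Rightarrow> real measure" where
  "poisson_law r = distr (measure_pmf (poisson_pmf r)) borel real"

lemma measure_bernoulli_law:
  assumes "0 \<le> p" "p \<le> 1"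
  shows "measure (bernoulli_law p) {1} = p" "measure (bernoulli_law p) {0} = 1 - p"
proof -
  have "of_bool -` {1::real} = {True}" "of_bool -` {0::real} = {False}" by auto
  then show "measure (bernoulli_law p) {1} = p" "measure (bernoulli_law p) {0} = 1 - p"
    using assms by (simp_all add: bernoulli_law_def measure_distr measure_pmf_single)
qed

lemma measure_poisson_law:
  assumes "0 < r"
  shows "measure (poisson_law r) {real i} = r ^ i / fact i * exp (- r)"
proof -
  have "real -` {real i} = {i}" by auto
  then show ?thesis
    using assms by (simp add: poisson_law_def measure_distr measure_pmf_single)
qed

end

(*
  By Levy's continuity theorem it suffices to show convergence of characteristic functions.
  With z = exp(it) - 1, that of the n-th row sum is the product of the factors 1 + p z, and that
  of the Poisson law is exp(lam z). Each factor 1 + p z differs from exp(p z) by O(p^2), and both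
  lie in the unit disc, so the product differs from exp(z * sum p) by O(max p * sum p).
*)
theory Submission
  imports Defs
begin

lemma real_distribution_bernoulli_law: "real_distribution (bernoulli_law p)"
  unfolding bernoulli_law_def by (intro prob_space.real_distribution_distr prob_space_measure_pmf) simp

lemma real_distribution_poisson_law: "real_distribution (poisson_law r)"
  unfolding poisson_law_def by (intro prob_space.real_distribution_distr prob_space_measure_pmf) simp

lemma char_bernoulli_law:
  assumes "0 \<le> p" "p \<le> 1"
  shows "char (bernoulli_law p) t = 1 + of_real p * (iexp t - 1)"
proof -
  have "char (bernoulli_law p) t = (CLINT b|bernoulli_pmf p. iexp (t * of_bool b))"
    unfolding char_def bernoulli_law_def by (subst integral_distr) auto
  also have "\<dots> = (\<Sum>b\<in>UNIV. pmf (bernoulli_pmf p) b *\<^sub>R iexp (t * of_bool b))"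
    by (rule integral_measure_pmf) auto
  also have "\<dots> = 1 + of_real p * (iexp t - 1)"
    using assms by (simp add: UNIV_bool scaleR_conv_of_real algebra_simps)
  finally show ?thesis .
qed

text \<open>The Poisson probabilities are weights on the naturals, so the integral is a series, and
  up to the factor \<open>exp (- r)\<close> it is the exponential series at
  \<open>r * iexp t\<close>. Uniqueness of sums identifies the two values.\<close>

lemma char_poisson_law:
  assumes "0 < r"
  shows "char (poisson_law r) t = exp (of_real r * (iexp t - 1))"
proof -
  let ?f = "\<lambda>k. pmf (poisson_pmf r) k *\<^sub>R iexp (t * real k)"
  \<comment> \<open>Integrability moves to the counting measure, where it licenses reading the
    integral as a convergent series.\<close>
  have "integrable (measure_pmf (poisson_pmf r)) (\<lambda>k. iexp (t * real k))"
    by (rule prob_space.integrable_iexp[OF prob_space_measure_pmf]) auto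
  then have int: "integrable (count_space UNIV) ?f"
    unfolding measure_pmf_eq_density by (subst (asm) integrable_density) auto
  have "char (poisson_law r) t = (CLINT k|measure_pmf (poisson_pmf r). iexp (t * real k))"
    unfolding char_def poisson_law_def by (subst integral_distr) auto
  also have "\<dots> = (CLINT k|count_space UNIV. ?f k)"
    unfolding measure_pmf_eq_density by (subst integral_density) auto
  finally have "?f sums char (poisson_law r) t"
    using sums_integral_count_space_nat[OF int] by simp
  moreover have "?f sums exp (of_real r * (iexp t - 1))"
  proof -
    have "iexp (t * real k) = iexp t ^ k" for k
      by (simp add: mult_ac flip: exp_of_nat_mult)
    then have "?f = (\<lambda>k. of_real (exp (- r)) * ((of_real r * iexp t) ^ k /\<^sub>R fact k))"
      using assms by (simp add: fun_eq_iff scaleR_conv_of_real power_mult_distrib divide_inverse)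
    moreover have "\<dots> sums (of_real (exp (- r)) * exp (of_real r * iexp t))"
      by (intro sums_mult exp_converges)
    moreover have "of_real (exp (- r)) * exp (of_real r * iexp t) = exp (of_real r * (iexp t - 1))"
      unfolding exp_of_real[symmetric] mult_exp_exp by (simp add: right_diff_distrib)
    ultimately show ?thesis by simp
  qed
  ultimately show ?thesis by (rule sums_unique2)
qed

text \<open>First-order Taylor remainder of \<open>exp\<close>: its factor
  \<open>exp \<bar>Re w\<bar>\<close> is at most \<open>exp 2\<close> on the disc of radius
  2.\<close>

lemma norm_one_plus_minus_exp_le:
  fixes w :: complex
  assumes "norm w \<le> 2"
  shows "norm (1 + w - exp w) \<le> exp 2 * norm w ^ 2"
proof -
  have "norm (exp w - (1 + w)) \<le> exp \<bar>Re w\<bar> * norm w ^ 2"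
    using Taylor_exp[of w 1] by (simp add: numeral_2_eq_2)
  also have "\<dots> \<le> exp 2 * norm w ^ 2"
    using abs_Re_le_cmod[of w] assms by (intro mult_right_mono) auto
  finally show ?thesis by (simp add: norm_minus_commute)
qed

text \<open>Errors of factors in the closed unit disc add up at most linearly under products. Each
  error is quadratic in \<open>p i\<close>; one of the two factors \<open>p i\<close> is bounded by
  \<open>m\<close>, the other is summed.\<close>

lemma norm_prod_one_plus_minus_exp_le:
  fixes z :: complex
  assumes z: "norm (1 + z) \<le> 1"
    and p: "\<And>i. i \<in> I \<Longrightarrow> 0 \<le> p i" "\<And>i. i \<in> I \<Longrightarrow> p i \<le> 1" "\<And>i. i \<in> I \<Longrightarrow> p i \<le> m"
  shows "norm ((\<Prod>i\<in>I. 1 + of_real (p i) * z) - exp (of_real (\<Sum>i\<in>I. p i) * z))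
    \<le> 4 * exp 2 * (m * (\<Sum>i\<in>I. p i))"
proof (cases "finite I")
  case True
  have "norm z \<le> norm (1 + z) + norm (1 :: complex)"
    using norm_triangle_ineq4[of "1 + z" 1] by simp
  then have z2: "norm z \<le> 2" using z by simp
  have Re: "Re z \<le> 0"
    using complex_Re_le_cmod[of "1 + z"] z by simp
  have factor: "norm (1 + of_real (p i) * z) \<le> 1" if "i \<in> I" for i
  proof -
    \<comment> \<open>A convex combination of 1 and \<open>1 + z\<close>, both in the unit
      disc.\<close>
    have "1 + of_real (p i) * z = of_real (1 - p i) + of_real (p i) * (1 + z)"
      by (simp add: algebra_simps)
    also have "norm \<dots> \<le> norm (of_real (1 - p i) :: complex) + norm (of_real (p i) * (1 + z))"
      by (rule norm_triangle_ineq)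
    also have "\<dots> = (1 - p i) + p i * norm (1 + z)"
      using p[OF that] by (simp add: norm_mult del: of_real_diff)
    also have "\<dots> \<le> 1"
      using p(1)[OF that] z by (simp add: mult_left_le)
    finally show ?thesis .
  qed
  \<comment> \<open>The modulus is \<open>exp (p i * Re z)\<close>, with nonpositive
    exponent.\<close>
  have exp_factor: "norm (exp (of_real (p i) * z)) \<le> 1" if "i \<in> I" for i
    using p(1)[OF that] Re by (simp add: mult_nonneg_nonpos)
  have diff: "norm (1 + of_real (p i) * z - exp (of_real (p i) * z)) \<le> 4 * exp 2 * (m * p i)"
    if "i \<in> I" for i
  proof -
    have "norm (of_real (p i) * z) = p i * norm z"
      using p(1)[OF that] by (simp add: norm_mult)
    moreover have "p i * norm z \<le> p i * 2"
      using p(1)[OF that] z2 by (rule mult_left_mono[rotated])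
    \<comment> \<open>This bound, squared, gives the constant 4; with \<open>p i \<le> 1\<close> it
      also keeps the argument within the radius 2 of the Taylor estimate.\<close>
    ultimately have le: "norm (of_real (p i) * z) \<le> 2 * p i" by simp
    have "norm (1 + of_real (p i) * z - exp (of_real (p i) * z)) \<le> exp 2 * norm (of_real (p i) * z) ^ 2"
      using le p(2)[OF that] by (intro norm_one_plus_minus_exp_le) simp
    also have "\<dots> \<le> exp 2 * (2 * p i) ^ 2"
      using le by (intro mult_left_mono power_mono) auto
    also have "\<dots> = 4 * exp 2 * (p i * p i)"
      by (simp add: power2_eq_square)
    also have "\<dots> \<le> 4 * exp 2 * (m * p i)"
      using p(1,3)[OF that] by (intro mult_left_mono mult_right_mono) auto
    finally show ?thesis .
  qed
  have "exp (of_real (\<Sum>i\<in>I. p i) * z) = (\<Prod>i\<in>I. exp (of_real (p i) * z))"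
    using True by (simp add: exp_sum sum_distrib_right)
  then have "norm ((\<Prod>i\<in>I. 1 + of_real (p i) * z) - exp (of_real (\<Sum>i\<in>I. p i) * z))
    \<le> (\<Sum>i\<in>I. norm (1 + of_real (p i) * z - exp (of_real (p i) * z)))"
    using norm_prod_diff[OF factor exp_factor] by simp
  also have "\<dots> \<le> (\<Sum>i\<in>I. 4 * exp 2 * (m * p i))"
    by (intro sum_mono diff)
  finally show ?thesis by (simp add: sum_distrib_left)
\<comment> \<open>For infinite \<open>I\<close> the product is 1 and the sum 0 by convention, so
  both sides vanish.\<close>
qed simp

theorem theorem1:
  fixes M :: "'a measure"
    and X :: "nat \<Rightarrow> nat \<Rightarrow> 'a \<Rightarrow> real"
    and p :: "nat \<Rightarrow> nat \<Rightarrow> real"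
    and k :: "nat \<Rightarrow> nat"
    and lam :: real
  assumes "prob_space M"
    and "\<And>n. n \<ge> 1 \<Longrightarrow> k n \<ge> 1"
    and "filterlim k at_top sequentially"
    and "\<And>n. n \<ge> 1 \<Longrightarrow>
           prob_space.indep_vars M (\<lambda>_. borel) (\<lambda>j. X j n) {1..k n}"
    and "\<And>n j. n \<ge> 1 \<Longrightarrow> j \<in> {1..k n} \<Longrightarrow> 0 < p j n \<and> p j n < 1"
    and "\<And>n j. n \<ge> 1 \<Longrightarrow> j \<in> {1..k n} \<Longrightarrow> distr M borel (X j n) = bernoulli_law (p j n)"
    and "(\<lambda>n. SUP j\<in>{1..k n}. p j n) \<longlonglongrightarrow> 0"
    and "(\<lambda>n. \<Sum>j=1..k n. p j n) \<longlonglongrightarrow> lam"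
    and "0 < lam"
  shows "weak_conv_m (\<lambda>n. distr M borel (\<lambda>\<omega>. \<Sum>j=1..k n. X j n \<omega>)) (poisson_law lam)"
proof -
  interpret prob_space M by fact
  note indep = assms(4) and p01 = assms(5) and distr_X = assms(6)
    and sup_p = assms(7) and sum_p = assms(8)
  define S where "S n = distr M borel (\<lambda>\<omega>. \<Sum>j=1..k n. X j n \<omega>)" for n
  have S_distr: "real_distribution (S n)" if "n \<ge> 1" for n
    using indep[OF that] unfolding S_def indep_vars_def
    by (intro real_distribution_distr borel_measurable_sum) auto
  have char_S: "char (S n) t = (\<Prod>j=1..k n. 1 + of_real (p j n) * (iexp t - 1))" if "n \<ge> 1" for n t
    unfolding S_def char_distr_sum[OF indep[OF that]]
    using p01[OF that] by (intro prod.cong refl) (simp add: distr_X[OF that] char_bernoulli_law less_imp_le)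
  have char_lim: "(\<lambda>n. char (S n) t) \<longlonglongrightarrow> char (poisson_law lam) t" for t
  proof -
    define z where "z = iexp t - 1"
    let ?E = "\<lambda>n. exp (of_real (\<Sum>j=1..k n. p j n) * z)"
    have z: "norm (1 + z) \<le> 1" by (simp add: z_def)
    \<comment> \<open>The row maximum serves as \<open>m\<close>; it is an upper bound because the
      row is finite.\<close>
    have bound: "norm (char (S n) t - ?E n)
      \<le> 4 * exp 2 * ((SUP j\<in>{1..k n}. p j n) * (\<Sum>j=1..k n. p j n))" if "n \<ge> 1" for n
      unfolding char_S[OF that] z_def[symmetric]
      using p01[OF that] by (intro norm_prod_one_plus_minus_exp_le z cSUP_upper) (auto simp: less_imp_le)
    have "(\<lambda>n. 4 * exp 2 * ((SUP j\<in>{1..k n}. p j n) * (\<Sum>j=1..k n. p j n)))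
      \<longlonglongrightarrow> 4 * exp 2 * (0 * lam)"
      by (intro tendsto_mult_left tendsto_mult sup_p sum_p)
    then have "(\<lambda>n. char (S n) t - ?E n) \<longlonglongrightarrow> 0"
      by (intro Lim_null_comparison[OF eventually_mono[OF eventually_ge_at_top bound]]) simp_all
    moreover have "?E \<longlonglongrightarrow> exp (of_real lam * z)"
      by (intro tendsto_intros sum_p)
    ultimately have "(\<lambda>n. char (S n) t) \<longlonglongrightarrow> exp (of_real lam * z)"
      by (rule Lim_transform[rotated])
    then show ?thesis
      using char_poisson_law[OF \<open>0 < lam\<close>] by (simp add: z_def)
  qed
  \<comment> \<open>Nothing is assumed about row \<open>0\<close>, where the sum need not even be measurable.\<close>
  have "weak_conv_m (\<lambda>n. S (Suc n)) (poisson_law lam)"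
    by (rule levy_continuity) (simp_all add: S_distr real_distribution_poisson_law LIMSEQ_Suc[OF char_lim])
  \<comment> \<open>Weak convergence means convergence of the distribution functions at the
    continuity points of the limit. At each such point this is a limit of real numbers, so the index
    shift can be undone.\<close>
  then show ?thesis
    unfolding weak_conv_m_def weak_conv_def S_def[symmetric]
    using LIMSEQ_imp_Suc[where f="\<lambda>n. cdf (S n) x" for x] by blast
qed

end
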